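(* Let $(X,\|\cdot\|)$ be a real normed space and let $C\subset X$. (a) If $\varphi:X\to\mathbb R$ is Fréchet differentiable at $x_0\in C$ and $x_0$ is a local minimizer of $\varphi$ over $C$, then $-\nabla\varphi(x_0)\in N_C^{\eth}(x_0)$. (b) If $F:C\to X^*$ and $x_0\in C$ satisfies the local variational inequality $\langle y-x_0,F(x_0)\rangle\ge0$ for all $y\in C$ near $x_0$, then $-F(x_0)\in N_C^{\eth}(x_0)$. (c) If $C$ is convex, then $N_C^{\eth}(x)=N_C(x)$ for every $x\in C$, where $N_C(x)$ is the usual convex normal cone. If $x\notin C$, then $N_C^{\eth}(x)=\emptyset$.
   Context: $\overline{\mathbb R}=[-\infty,+\infty]$, $\langle x,x^*\rangle:=x^*(x)$, and $\overline B(x_0;r)$ is the closed norm ball. Core subdifferential (for the norm metric): for $f:X\to\overline{\mathbb R}$ and $x_0\in X$, $x_0^*\in X^*$ belongs to $\eth f(x_0)$ if $f(x_0)\in\mathbb R$ and there is a family $(\delta_\varepsilon)_{\varepsilon>0}\subset(0,+\infty)$ with $\limsup_{\varepsilon\downarrow0}\delta_\varepsilon/\varepsilon=+\infty$ such that $f(x_0)+\langle x-x_0,x_0^*\rangle\le f(x)+\varepsilon$ for every $\varepsilon>0$ and every $x\in\overline B(x_0;\delta_\varepsilon)$. If $f(x_0)\notin\mathbb R$, then $\eth f(x_0)=\emptyset$. The indicator function $\iota_C$ equals $0$ on $C$ and $+\infty$ off $C$. The core normal cone is $N_C^{\eth}(x):=\eth\iota_C(x)$. For convex $C$ and $x\in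 C$, $N_C(x)=\{x^*\in X^*\mid\langle y-x,x^*\rangle\le0\ \forall y\in C\}$. *)

theory Defs
  imports "HOL-Analysis.Analysis"
begin

text \<open>The topological dual of a real normed space \<open>'a\<close> is the type \<open>'a \<Rightarrow>\<^sub>L real\<close> of
  bounded linear functionals. A family \<open>(\<delta>\<^sub>\<epsilon>)\<close> over \<open>\<epsilon> > 0\<close> is a function
  \<open>\<delta> :: real \<Rightarrow> real\<close> whose values at \<open>\<epsilon> \<le> 0\<close> play no role.\<close>

definition core_subdifferential ::
    "('a::real_normed_vector \<Rightarrow> ereal) \<Rightarrow> 'a \<Rightarrow> ('a \<Rightarrow>\<^sub>L real) set" where
  "core_subdifferential f x0 =
    {x0'. \<bar>f x0\<bar> \<noteq> \<infinity> \<and>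
      (\<exists>\<delta>::real \<Rightarrow> real.
        (\<forall>\<epsilon>>0. \<delta> \<epsilon> > 0) \<and>
        Limsup (at_right 0) (\<lambda>\<epsilon>. ereal (\<delta> \<epsilon> / \<epsilon>)) = \<infinity> \<and>
        (\<forall>\<epsilon>>0. \<forall>x\<in>cball x0 (\<delta> \<epsilon>).
          f x0 + ereal (blinfun_apply x0' (x - x0)) \<le> f x + ereal \<epsilon>))}"

definition indicator_function :: "'a set \<Rightarrow> 'a \<Rightarrow> ereal" where
  "indicator_function C x = (if x \<in> C then 0 else \<infinity>)"

definition core_normal_cone ::
    "'a::real_normed_vector set \<Rightarrow> 'a \<Rightarrow> ('a \<Rightarrow>\<^sub>L real) set" where
  "core_normal_cone C x = core_subdifferential (indicator_function C) x"

text \<open>The usual normal cone of convex analysis; only meaningful for convex \<open>C\<close> and \<open>x \<in> C\<close>.\<close>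

definition convex_normal_cone ::
    "'a::real_normed_vector set \<Rightarrow> 'a \<Rightarrow> ('a \<Rightarrow>\<^sub>L real) set" where
  "convex_normal_cone C x = {x'. \<forall>y\<in>C. blinfun_apply x' (y - x) \<le> 0}"

end

theory Submission
  imports Defs
begin

text \<open>At a point of \<open>C\<close>, membership in the core normal cone asks for radii \<open>\<delta>\<^sub>\<epsilon>\<close> on which the
  functional exceeds its value at the base point by at most \<open>\<epsilon>\<close> along \<open>C\<close>, with
  \<open>\<delta>\<^sub>\<epsilon> / \<epsilon>\<close> unbounded as \<open>\<epsilon>\<close> tends to zero. At distance
  \<open>\<delta>\<^sub>\<epsilon>\<close> from the base point the slope of the functional along \<open>C\<close> is then at most \<open>\<epsilon> / \<delta>\<^sub>\<epsilon>\<close>,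
  which becomes arbitrarily small along some sequence of \<open>\<epsilon>\<close> tending to zero.

  A functional whose positive part along \<open>C\<close> is \<open>o(\<parallel>y - x\<^sub>0\<parallel>)\<close>, a Frechet normal, satisfies
  this even with a genuine limit: if its slope is at most \<open>1/K\<close> on a ball, the radius
  \<open>K\<epsilon>\<close> is admissible for all small \<open>\<epsilon>\<close>. This is \<open>core_normal_cone_if_frechet_normal\<close>. Negated
  gradients at local minimizers, the functionals \<open>- F x\<^sub>0\<close> at solutions of the local variational
  inequality, and convex normals are all Frechet normals.

  For convex \<open>C\<close> the converse holds because slopes are scale invariant along a segment: a
  functional with positive slope in some direction \<open>y - x\<close> has that same slope at every scale up
  to \<open>\<parallel>y - x\<parallel>\<close>, and this bounds \<open>\<delta>\<^sub>\<epsilon> / \<epsilon>\<close> for small \<open>\<epsilon>\<close>. This is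
  \<open>core_normal_cone_subset_convex_normal_cone\<close>.\<close>

lemma core_normal_cone_iff:
  fixes C :: "'a::real_normed_vector set"
  assumes "x0 \<in> C"
  shows "x' \<in> core_normal_cone C x0 \<longleftrightarrow>
    (\<exists>\<delta>::real \<Rightarrow> real. (\<forall>\<epsilon>>0. \<delta> \<epsilon> > 0) \<and>
        Limsup (at_right 0) (\<lambda>\<epsilon>. ereal (\<delta> \<epsilon> / \<epsilon>)) = \<infinity> \<and>
        (\<forall>\<epsilon>>0. \<forall>y\<in>C \<inter> cball x0 (\<delta> \<epsilon>). blinfun_apply x' (y - x0) \<le> \<epsilon>))"
proof -
  have eq: "(\<forall>y\<in>cball x0 d. indicator_function C x0 + ereal (blinfun_apply x' (y - x0))
          \<le> indicator_function C y + ereal \<epsilon>)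
      \<longleftrightarrow> (\<forall>y\<in>C \<inter> cball x0 d. blinfun_apply x' (y - x0) \<le> \<epsilon>)" for d \<epsilon>
    using assms by (auto simp: indicator_function_def)
  show ?thesis
    using assms unfolding core_normal_cone_def core_subdifferential_def mem_Collect_eq eq
    by (simp add: indicator_function_def)
qed

lemma core_normal_cone_outside:
  assumes "x \<notin> C"
  shows "core_normal_cone C x = {}"
  using assms
  by (simp add: core_normal_cone_def core_subdifferential_def indicator_function_def)

text \<open>For each \<open>\<epsilon>\<close> the radius is taken to be nearly the largest admissible one, capped at \<open>1\<close>;
  it then dominates, up to the factor \<open>1/2\<close>, every multiple \<open>K\<epsilon>\<close> that the slope bounds make
  admissible.\<close>

lemma core_normal_cone_if_frechet_normal:
  fixes C :: "'a::real_normed_vector set" and x' :: "'a \<Rightarrow>\<^sub>L real"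
  assumes x0: "x0 \<in> C"
    and frechet: "\<And>\<eta>. \<eta> > 0 \<Longrightarrow>
      \<forall>\<^sub>F y in nhds x0. y \<in> C \<longrightarrow> blinfun_apply x' (y - x0) \<le> \<eta> * norm (y - x0)"
  shows "x' \<in> core_normal_cone C x0"
proof -
  define S where "S \<epsilon> = {d. 0 < d \<and> d \<le> 1 \<and>
      (\<forall>y\<in>C \<inter> cball x0 d. blinfun_apply x' (y - x0) \<le> \<epsilon>)}" for \<epsilon>
  have bdd: "bdd_above (S \<epsilon>)" for \<epsilon>
    unfolding S_def by (intro bdd_aboveI[of _ 1]) auto
  have S_I: "K * \<epsilon> \<in> S \<epsilon>"
    if "K > 0" "\<epsilon> > 0" "K * \<epsilon> \<le> 1"
      and le: "\<And>y. y \<in> C \<Longrightarrow> dist y x0 \<le> K * \<epsilon> \<Longrightarrow>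
        blinfun_apply x' (y - x0) \<le> 1 / K * norm (y - x0)" for K \<epsilon>
  proof -
    have "blinfun_apply x' (y - x0) \<le> \<epsilon>" if y: "y \<in> C \<inter> cball x0 (K * \<epsilon>)" for y
    proof -
      have d: "dist y x0 \<le> K * \<epsilon>" using y by (simp add: dist_commute)
      have "blinfun_apply x' (y - x0) \<le> 1 / K * norm (y - x0)" using le y d by blast
      also have "\<dots> \<le> 1 / K * (K * \<epsilon>)"
        using d \<open>K > 0\<close> by (intro mult_left_mono) (auto simp: dist_norm)
      finally show ?thesis using \<open>K > 0\<close> by simp
    qed
    then show ?thesis using that by (simp add: S_def)
  qed
  have nonempty: "S \<epsilon> \<noteq> {}" if "\<epsilon> > 0" for \<epsilon>
  proof -
    \<comment> \<open>The operator norm bounds the slope everywhere, and the other term enforces the cap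
      \<open>K * \<epsilon> \<le> 1\<close>.\<close>
    define K where "K = min (1 / \<epsilon>) (1 / (norm x' + 1))"
    have n: "norm x' + 1 > 0" using norm_ge_zero[of x'] by linarith
    have K: "K > 0" using n that by (simp add: K_def)
    have "K \<le> 1 / \<epsilon>" "K \<le> 1 / (norm x' + 1)" by (simp_all add: K_def)
    then have "K * \<epsilon> \<le> 1" "norm x' \<le> 1 / K"
      using K n that by (simp_all add: field_simps)
    moreover have "blinfun_apply x' z \<le> 1 / K * norm z" for z
    proof -
      have "blinfun_apply x' z \<le> norm x' * norm z"
        using norm_blinfun[of x' z] by simp
      also have "\<dots> \<le> 1 / K * norm z"
        using \<open>norm x' \<le> 1 / K\<close> by (intro mult_right_mono) simp_all
      finally show ?thesis .
    qed
    ultimately have "K * \<epsilon> \<in> S \<epsilon>"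
      using K that by (intro S_I) simp_all
    then show ?thesis by blast
  qed
  have "\<exists>d\<in>S \<epsilon>. Sup (S \<epsilon>) / 2 < d" if pos: "\<epsilon> > 0" for \<epsilon>
  proof -
    obtain d where d: "d \<in> S \<epsilon>" using nonempty[OF pos] by blast
    have "0 < d" using d by (simp add: S_def)
    also have "d \<le> Sup (S \<epsilon>)" using d bdd by (rule cSup_upper)
    finally have "Sup (S \<epsilon>) / 2 < Sup (S \<epsilon>)" by simp
    then show ?thesis using less_cSup_iff[OF nonempty[OF pos] bdd] by blast
  qed
  then obtain \<delta> where \<delta>: "\<And>\<epsilon>. \<epsilon> > 0 \<Longrightarrow> \<delta> \<epsilon> \<in> S \<epsilon> \<and> Sup (S \<epsilon>) / 2 < \<delta> \<epsilon>"
    by metis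
  have large: "\<forall>\<^sub>F \<epsilon> in at_right 0. K / 2 < \<delta> \<epsilon> / \<epsilon>" if K: "K > 0" for K
  proof -
    obtain r where r: "r > 0"
      "\<And>y. dist y x0 < r \<Longrightarrow> y \<in> C \<Longrightarrow> blinfun_apply x' (y - x0) \<le> 1 / K * norm (y - x0)"
      using frechet[of "1 / K"] K unfolding eventually_nhds_metric by auto
    have "\<forall>\<^sub>F \<epsilon> in at_right 0. 0 < \<epsilon> \<and> \<epsilon> < min (1 / K) (r / K)"
      using K r(1) unfolding eventually_at_right_field
      by (intro exI[of _ "min (1 / K) (r / K)"]) simp
    then show ?thesis
    proof eventually_elim
      case (elim \<epsilon>)
      then have b: "K * \<epsilon> \<le> 1" "K * \<epsilon> < r" using K by (auto simp: field_simps)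
      have "K * \<epsilon> \<in> S \<epsilon>"
        using K elim b r(2) by (intro S_I) auto
      then have "K * \<epsilon> \<le> Sup (S \<epsilon>)" using bdd by (rule cSup_upper)
      with \<delta>[of \<epsilon>] elim show ?case by (simp add: field_simps)
    qed
  qed
  have "((\<lambda>\<epsilon>. ereal (\<delta> \<epsilon> / \<epsilon>)) \<longlongrightarrow> \<infinity>) (at_right 0)"
    unfolding tendsto_PInfty
  proof
    fix M :: real
    have "\<forall>\<^sub>F \<epsilon> in at_right 0. (2 * max M 1) / 2 < \<delta> \<epsilon> / \<epsilon>"
      by (rule large) simp
    then show "\<forall>\<^sub>F \<epsilon> in at_right 0. ereal M < ereal (\<delta> \<epsilon> / \<epsilon>)"
      by eventually_elim simp
  qed
  then have "Limsup (at_right 0) (\<lambda>\<epsilon>. ereal (\<delta> \<epsilon> / \<epsilon>)) = \<infinity>"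
    by (intro lim_imp_Limsup) auto
  moreover have "\<forall>\<epsilon>>0. \<delta> \<epsilon> > 0"
    and "\<forall>\<epsilon>>0. \<forall>y\<in>C \<inter> cball x0 (\<delta> \<epsilon>). blinfun_apply x' (y - x0) \<le> \<epsilon>"
    using \<delta> by (auto simp: S_def)
  ultimately show ?thesis unfolding core_normal_cone_iff[OF x0] by blast
qed

lemma core_normal_cone_if_locally_nonpos:
  fixes C :: "'a::real_normed_vector set" and x' :: "'a \<Rightarrow>\<^sub>L real"
  assumes "x0 \<in> C" "\<forall>\<^sub>F y in nhds x0. y \<in> C \<longrightarrow> blinfun_apply x' (y - x0) \<le> 0"
  shows "x' \<in> core_normal_cone C x0"
proof (rule core_normal_cone_if_frechet_normal[OF assms(1)])
  fix \<eta> :: real assume \<eta>: "\<eta> > 0"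
  show "\<forall>\<^sub>F y in nhds x0. y \<in> C \<longrightarrow> blinfun_apply x' (y - x0) \<le> \<eta> * norm (y - x0)"
    using assms(2)
  proof eventually_elim
    case (elim y)
    moreover have "0 \<le> \<eta> * norm (y - x0)" using \<eta> by simp
    ultimately show ?case by (blast intro: order_trans)
  qed
qed

text \<open>The first-order expansion of \<open>\<phi>\<close>, combined with \<open>\<phi> x0 \<le> \<phi> y\<close> along \<open>C\<close>, leaves only the
  Frechet remainder as an upper bound for the negated gradient.\<close>

lemma neg_gradient_in_core_normal_cone:
  fixes C :: "'a::real_normed_vector set" and grad :: "'a \<Rightarrow>\<^sub>L real"
  assumes x0: "x0 \<in> C"
    and deriv: "(\<phi> has_derivative blinfun_apply grad) (at x0)"
    and minimizer: "\<forall>\<^sub>F y in nhds x0. y \<in> C \<longrightarrow> \<phi> x0 \<le> \<phi> y"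
  shows "- grad \<in> core_normal_cone C x0"
proof (rule core_normal_cone_if_frechet_normal[OF x0])
  fix \<eta> :: real assume "\<eta> > 0"
  then obtain d where "d > 0"
    and d: "\<And>y. norm (y - x0) < d \<Longrightarrow>
      norm (\<phi> y - \<phi> x0 - blinfun_apply grad (y - x0)) \<le> \<eta> * norm (y - x0)"
    using deriv unfolding has_derivative_at_alt by blast
  then have "\<forall>\<^sub>F y in nhds x0. dist y x0 < d"
    unfolding eventually_nhds_metric by blast
  with minimizer
  show "\<forall>\<^sub>F y in nhds x0. y \<in> C \<longrightarrow> blinfun_apply (- grad) (y - x0) \<le> \<eta> * norm (y - x0)"
  proof eventually_elim
    case (elim y)
    with d[of y] show ?case
      by (auto simp: dist_norm uminus_blinfun.rep_eq)
  qed
qed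

text \<open>If \<open>a = \<langle>y - x, x'\<rangle>\<close> were positive, moving from \<open>x\<close> towards \<open>y\<close> by the full radius \<open>\<delta>\<^sub>\<epsilon>\<close>
  would raise the functional by \<open>a \<delta>\<^sub>\<epsilon> / \<parallel>y - x\<parallel>\<close>. As this is at most \<open>\<epsilon>\<close>, the ratio
  \<open>\<delta>\<^sub>\<epsilon> / \<epsilon>\<close> would not exceed \<open>\<parallel>y - x\<parallel> / a\<close> for small \<open>\<epsilon>\<close>.\<close>

lemma core_normal_cone_subset_convex_normal_cone:
  fixes C :: "'a::real_normed_vector set"
  assumes "convex C" and x: "x \<in> C"
  shows "core_normal_cone C x \<subseteq> convex_normal_cone C x"
proof
  fix x' assume "x' \<in> core_normal_cone C x"
  then obtain \<delta> :: "real \<Rightarrow> real" where pos: "\<And>\<epsilon>. \<epsilon> > 0 \<Longrightarrow> \<delta> \<epsilon> > 0"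
    and lim: "Limsup (at_right 0) (\<lambda>\<epsilon>. ereal (\<delta> \<epsilon> / \<epsilon>)) = \<infinity>"
    and le: "\<And>\<epsilon> y. \<epsilon> > 0 \<Longrightarrow> y \<in> C \<Longrightarrow> dist x y \<le> \<delta> \<epsilon> \<Longrightarrow> blinfun_apply x' (y - x) \<le> \<epsilon>"
    unfolding core_normal_cone_iff[OF x] by (metis IntI mem_cball)
  have "blinfun_apply x' (y - x) \<le> 0" if y: "y \<in> C" for y
  proof (rule ccontr)
    define a where "a = blinfun_apply x' (y - x)"
    define n where "n = norm (y - x)"
    assume "\<not> blinfun_apply x' (y - x) \<le> 0"
    then have a: "a > 0" by (simp add: a_def)
    then have "y \<noteq> x" by (auto simp: a_def blinfun.zero_right)
    then have n: "n > 0" by (simp add: n_def)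
    have "\<forall>\<^sub>F \<epsilon> in at_right 0. 0 < \<epsilon> \<and> \<epsilon> < a"
      using a by (auto simp: eventually_at_right_field)
    then have "\<forall>\<^sub>F \<epsilon> in at_right 0. ereal (\<delta> \<epsilon> / \<epsilon>) \<le> ereal (n / a)"
    proof eventually_elim
      case (elim \<epsilon>)
      have \<delta>: "\<delta> \<epsilon> > 0" using pos elim by blast
      \<comment> \<open>The point \<open>y\<close> itself violates the bound \<open>\<epsilon> < a\<close>, so the ball does not reach it.\<close>
      have small: "\<delta> \<epsilon> < n"
      proof (rule ccontr)
        assume "\<not> \<delta> \<epsilon> < n"
        then have "a \<le> \<epsilon>"
          using le[of \<epsilon> y] elim y by (simp add: a_def n_def dist_norm norm_minus_commute)
        with elim show False by simp
      qed
      define t where "t = \<delta> \<epsilon> / n"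
      have t: "0 \<le> t" "t \<le> 1" using \<delta> n small by (simp_all add: t_def)
      have "(1 - t) *\<^sub>R x + t *\<^sub>R y \<in> C"
        using \<open>convex C\<close> x y t unfolding convex_alt by blast
      moreover have "(1 - t) *\<^sub>R x + t *\<^sub>R y = x + t *\<^sub>R (y - x)"
        by (simp add: algebra_simps)
      ultimately have "x + t *\<^sub>R (y - x) \<in> C" by simp
      moreover have "dist x (x + t *\<^sub>R (y - x)) \<le> \<delta> \<epsilon>"
        using n \<delta> by (simp add: dist_norm t_def n_def)
      ultimately have "blinfun_apply x' (x + t *\<^sub>R (y - x) - x) \<le> \<epsilon>"
        using le elim by blast
      then have "t * a \<le> \<epsilon>"
        by (simp add: a_def blinfun.scaleR_right)
      then show ?case using a n elim by (simp add: t_def field_simps)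
    qed
    then have "Limsup (at_right 0) (\<lambda>\<epsilon>. ereal (\<delta> \<epsilon> / \<epsilon>)) \<le> ereal (n / a)"
      by (rule Limsup_bounded)
    with lim show False by simp
  qed
  then show "x' \<in> convex_normal_cone C x" by (simp add: convex_normal_cone_def)
qed

lemma convex_normal_cone_subset_core_normal_cone:
  fixes C :: "'a::real_normed_vector set"
  assumes "x \<in> C"
  shows "convex_normal_cone C x \<subseteq> core_normal_cone C x"
  using assms by (auto simp: convex_normal_cone_def intro!: core_normal_cone_if_locally_nonpos)

theorem proposition22:
  fixes C :: "'a::real_normed_vector set"
  shows
    "(\<forall>(\<phi> :: 'a \<Rightarrow> real) (grad :: 'a \<Rightarrow>\<^sub>L real). \<forall>x0\<in>C.
        (\<phi> has_derivative blinfun_apply grad) (at x0) \<longrightarrow>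
        (\<forall>\<^sub>F y in nhds x0. y \<in> C \<longrightarrow> \<phi> x0 \<le> \<phi> y) \<longrightarrow>
        - grad \<in> core_normal_cone C x0) \<and>
     (\<forall>F :: 'a \<Rightarrow> ('a \<Rightarrow>\<^sub>L real). \<forall>x0\<in>C.
        (\<forall>\<^sub>F y in nhds x0. y \<in> C \<longrightarrow> blinfun_apply (F x0) (y - x0) \<ge> 0) \<longrightarrow>
        - F x0 \<in> core_normal_cone C x0) \<and>
     (convex C \<longrightarrow> (\<forall>x\<in>C. core_normal_cone C x = convex_normal_cone C x)) \<and>
     (\<forall>x. x \<notin> C \<longrightarrow> core_normal_cone C x = {})"
proof (intro conjI allI ballI impI)
  fix \<phi> :: "'a \<Rightarrow> real" and grad :: "'a \<Rightarrow>\<^sub>L real" and x0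
  assume "x0 \<in> C" "(\<phi> has_derivative blinfun_apply grad) (at x0)"
    "\<forall>\<^sub>F y in nhds x0. y \<in> C \<longrightarrow> \<phi> x0 \<le> \<phi> y"
  then show "- grad \<in> core_normal_cone C x0"
    by (rule neg_gradient_in_core_normal_cone)
next
  fix F :: "'a \<Rightarrow> ('a \<Rightarrow>\<^sub>L real)" and x0
  assume "x0 \<in> C" "\<forall>\<^sub>F y in nhds x0. y \<in> C \<longrightarrow> blinfun_apply (F x0) (y - x0) \<ge> 0"
  then show "- F x0 \<in> core_normal_cone C x0"
    by (intro core_normal_cone_if_locally_nonpos) (simp_all add: uminus_blinfun.rep_eq)
next
  fix x assume "convex C" "x \<in> C"
  then show "core_normal_cone C x = convex_normal_cone C x"
    by (intro subset_antisym core_normal_cone_subset_convex_normal_cone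
        convex_normal_cone_subset_core_normal_cone)
next
  fix x assume "x \<notin> C"
  then show "core_normal_cone C x = {}" by (rule core_normal_cone_outside)
qed

end
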